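(* Let $N\ge2$, let $(p_i)_{i\ge1}$ be positive, $0\le r<t$ integers, $1<q_1<q_2<\dots<q_N$, $p_iq_j<1$ for all $i,j$, and let $\bm y=(y_1>\dots>y_N)\in\mathbb{Z}^N$. For $n\le N$ and $k\in\{0,\dots,n-1\}$, consider the terminal-boundary value problem for functions $h_k^n(\ell,x)$, $0\le\ell\le k$, $x\in\mathbb{Z}$: $$\begin{cases}h_k^n(\ell+1,x)=\big(h_k^n(\ell,\cdot)\circ Q_{n-\ell}^{-1}\big)(x), & x\in\mathbb{Z},\ \ell<k,\\ h_k^n(\ell,y_{n-\ell})=0, & \ell<k,\\ h_k^n(k,x)=q_{n-k}^{\,x-y_{n-k}}, & x\in\mathbb{Z}.\end{cases}$$ Then, for $0\le\ell\le k$, the functions $$h_k^n(\ell,x):=\big(\Phi_{n-k}^{(n)}\circ R^*_{(r,t]}\circ Q^{-1}_{(n-\ell,n]}\big)(x)$$ solve this problem. In particular, with this $h_k^n$, $$\Phi_{n-k}^{(n)}(x)=\big(h_k^n(0,\cdot)\circ(R^*_{(r,t]})^{-1}\big)(x).$$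
   Context: For a function $f$ and kernels on $\mathbb{Z}\times\mathbb{Z}$: $(f\circ A)(y)=\sum_xf(x)A(x,y)$, $(A\circ B)(x,z)=\sum_yA(x,y)B(y,z)$. $Q_i(x,y)=q_i^{y-x}\mathbf{1}_{\{y<x\}}$; $Q_i^{-1}(x,y)=-\mathbf{1}_{y=x}+q_i\mathbf{1}_{y=x+1}$; $Q_{(m,n]}=Q_{m+1}\circ\cdots\circ Q_n$ and $Q^{-1}_{(m,n]}=Q_n^{-1}\circ\cdots\circ Q_{m+1}^{-1}$ (identity if $m=n$); $R_i(x,y)=\mathbf{1}_{y=x}+p_i\mathbf{1}_{y=x+1}$; $R_i^*(x,y)=R_i(y,x)$; $R^*_{(r,t]}=R_t^*\circ\cdots\circ R_{r+1}^*$; $(R^*_{(r,t]})^{-1}$ is the composition over $r<i\le t$ of the (commuting) kernels $(R_i^* )^{-1}(x,y)=(-p_i)^{x-y}\mathbf{1}_{y\le x}$. $\Psi_k^{(N)}(x):=\big(R^*_{(r,t]}\circ Q^{-1}_{(k,N]}\big)(x,y_k)$ for $1\le k\le N$. Virtual variables: $Q_{[j,k]}(x_0^{(j-1)},x):=q_j^{x+k-j}/\prod_{\ell=j+1}^k(q_\ell-q_j)$ for $1\le j\le k$. $\mathsf{M}_{i,j}:=\sum_{z\in\mathbb{Z}}Q_{[i,N]}(x_0^{(i-1)},z)\Psi_j^{(N)}(z)$, $1\le i,j\le N$ (an upper-triangular invertible matrix); $\Phi_i^{(n)}(x):=\sum_{j=i}^n[\mathsf{M}^{-1}]_{i,j}\,Q_{[j,n]}(x_0^{(j-1)},x)$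 for $1\le i\le n$. *)

theory Defs
  imports "HOL-Analysis.Infinite_Sum" "Jordan_Normal_Form.Gauss_Jordan_Elimination"
begin

type_synonym kernel = "int \<Rightarrow> int \<Rightarrow> real"

text \<open>
  Sums over all of the integers are unordered sums. In every composition formed below, except
  for a function composed with \<^term>\<open>Rstar_inv p r t\<close>, each such sum has only finitely many
  nonzero terms.
\<close>

definition fcomp :: "(int \<Rightarrow> real) \<Rightarrow> kernel \<Rightarrow> int \<Rightarrow> real" (infixl "\<circ>\<^sub>f" 70)
  where "(f \<circ>\<^sub>f A) y = (\<Sum>\<^sub>\<infinity>x\<in>UNIV. f x * A x y)"

definition kcomp :: "kernel \<Rightarrow> kernel \<Rightarrow> kernel" (infixl "\<circ>\<^sub>k" 70)
  where "(A \<circ>\<^sub>k B) x z = (\<Sum>\<^sub>\<infinity>y\<in>UNIV. A x y * B y z)"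

definition id_kernel :: kernel
  where "id_kernel x y = (if y = x then 1 else 0)"

definition kprod :: "kernel list \<Rightarrow> kernel"
  where "kprod As = foldr (\<circ>\<^sub>k) As id_kernel"

definition Qinv :: "(nat \<Rightarrow> real) \<Rightarrow> nat \<Rightarrow> kernel"
  where "Qinv q i x y = - (if y = x then 1 else 0) + q i * (if y = x + 1 then 1 else 0)"

text \<open>The factors \<open>Q\<^sub>n\<inverse>, \<dots>, Q\<^sub>m\<^sub>+\<^sub>1\<inverse>\<close>, in this order; the identity if \<open>m = n\<close>.\<close>

definition Qinv_range :: "(nat \<Rightarrow> real) \<Rightarrow> nat \<Rightarrow> nat \<Rightarrow> kernel"
  where "Qinv_range q m n = kprod (map (Qinv q) (rev [Suc m..<Suc n]))"

definition R :: "(nat \<Rightarrow> real) \<Rightarrow> nat \<Rightarrow> kernel"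
  where "R p i x y = (if y = x then 1 else 0) + p i * (if y = x + 1 then 1 else 0)"

definition Rstar :: "(nat \<Rightarrow> real) \<Rightarrow> nat \<Rightarrow> kernel"
  where "Rstar p i x y = R p i y x"

definition Rstar_range :: "(nat \<Rightarrow> real) \<Rightarrow> nat \<Rightarrow> nat \<Rightarrow> kernel"
  where "Rstar_range p r t = kprod (map (Rstar p) (rev [Suc r..<Suc t]))"

definition Rstar_inv1 :: "(nat \<Rightarrow> real) \<Rightarrow> nat \<Rightarrow> kernel"
  where "Rstar_inv1 p i x y = (if y \<le> x then (- p i) powi (x - y) else 0)"

text \<open>The factors commute; their order is reversed with respect to \<^const>\<open>Rstar_range\<close>.\<close>

definition Rstar_inv :: "(nat \<Rightarrow> real) \<Rightarrow> nat \<Rightarrow> nat \<Rightarrow> kernel"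
  where "Rstar_inv p r t = kprod (map (Rstar_inv1 p) [Suc r..<Suc t])"

definition Psi ::
  "(nat \<Rightarrow> real) \<Rightarrow> (nat \<Rightarrow> real) \<Rightarrow> (nat \<Rightarrow> int) \<Rightarrow> nat \<Rightarrow> nat \<Rightarrow> nat \<Rightarrow> nat \<Rightarrow> int \<Rightarrow> real"
  where "Psi p q y r t N k x = (Rstar_range p r t \<circ>\<^sub>k Qinv_range q k N) x (y k)"

text \<open>\<open>Qvirt q j k x\<close> is \<open>Q\<^bsub>[j,k]\<^esub>\<close> evaluated at the virtual variable \<open>x\<^sub>0\<close> of level \<open>j - 1\<close> and
  at \<open>x\<close>, for \<open>1 \<le> j \<le> k\<close>.\<close>

definition Qvirt :: "(nat \<Rightarrow> real) \<Rightarrow> nat \<Rightarrow> nat \<Rightarrow> int \<Rightarrow> real"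
  where "Qvirt q j k x = q j powi (x + int k - int j) / (\<Prod>l = j + 1..k. q l - q j)"

definition M ::
  "(nat \<Rightarrow> real) \<Rightarrow> (nat \<Rightarrow> real) \<Rightarrow> (nat \<Rightarrow> int) \<Rightarrow> nat \<Rightarrow> nat \<Rightarrow> nat \<Rightarrow> nat \<Rightarrow> nat \<Rightarrow> real"
  where "M p q y r t N i j = (\<Sum>\<^sub>\<infinity>z\<in>UNIV. Qvirt q i N z * Psi p q y r t N j z)"

text \<open>Matrix indices start at 0, whereas \<open>i\<close> and \<open>j\<close> range over \<open>1, \<dots>, N\<close>.\<close>

definition M_mat ::
  "(nat \<Rightarrow> real) \<Rightarrow> (nat \<Rightarrow> real) \<Rightarrow> (nat \<Rightarrow> int) \<Rightarrow> nat \<Rightarrow> nat \<Rightarrow> nat \<Rightarrow> real mat"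
  where "M_mat p q y r t N = mat N N (\<lambda>(i, j). M p q y r t N (i + 1) (j + 1))"

definition M_inv ::
  "(nat \<Rightarrow> real) \<Rightarrow> (nat \<Rightarrow> real) \<Rightarrow> (nat \<Rightarrow> int) \<Rightarrow> nat \<Rightarrow> nat \<Rightarrow> nat \<Rightarrow> nat \<Rightarrow> nat \<Rightarrow> real"
  where "M_inv p q y r t N i j = the (mat_inverse (M_mat p q y r t N)) $$ (i - 1, j - 1)"

definition Phi ::
  "(nat \<Rightarrow> real) \<Rightarrow> (nat \<Rightarrow> real) \<Rightarrow> (nat \<Rightarrow> int) \<Rightarrow> nat \<Rightarrow> nat \<Rightarrow> nat \<Rightarrow> nat \<Rightarrow> nat \<Rightarrow> int \<Rightarrow> real"
  where "Phi p q y r t N n i x = (\<Sum>j = i..n. M_inv p q y r t N i j * Qvirt q j n x)"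

definition solves_terminal_boundary_problem ::
  "(nat \<Rightarrow> real) \<Rightarrow> (nat \<Rightarrow> int) \<Rightarrow> nat \<Rightarrow> nat \<Rightarrow> (nat \<Rightarrow> int \<Rightarrow> real) \<Rightarrow> bool"
  where "solves_terminal_boundary_problem q y n k h \<longleftrightarrow>
    (\<forall>l<k. \<forall>x. h (l + 1) x = (h l \<circ>\<^sub>f Qinv q (n - l)) x) \<and>
    (\<forall>l<k. h l (y (n - l)) = 0) \<and>
    (\<forall>x. h k x = q (n - k) powi (x - y (n - k)))"

definition h_sol ::
  "(nat \<Rightarrow> real) \<Rightarrow> (nat \<Rightarrow> real) \<Rightarrow> (nat \<Rightarrow> int) \<Rightarrow> nat \<Rightarrow> nat \<Rightarrow> nat \<Rightarrow> nat \<Rightarrow> nat \<Rightarrow> nat \<Rightarrow> int \<Rightarrow> real"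
  where "h_sol p q y r t N n k l x =
    (Phi p q y r t N n (n - k) \<circ>\<^sub>f Rstar_range p r t \<circ>\<^sub>f Qinv_range q (n - l) n) x"

end

theory Submission
  imports Defs "Jordan_Normal_Form.Determinant"
begin

text \<open>
  The operators \<^term>\<open>Qinv q i\<close>, \<^term>\<open>Rstar p i\<close> and \<^term>\<open>Rstar_inv1 p i\<close> are translation
  invariant, so each exponential \<open>x \<mapsto> a\<^sup>x\<close> with \<open>a > 0\<close> is an eigenfunction of them, with
  eigenvalues \<open>q\<^sub>i / a - 1\<close>, \<open>1 + p\<^sub>i a\<close> and \<open>1 / (1 + p\<^sub>i a)\<close>; in the last case the series is
  geometric with ratio \<open>- p\<^sub>i a\<close>, and it converges because \<open>0 < p\<^sub>i a < 1\<close> for \<open>a = q\<^sub>j\<close>. Up to a constant factor, the function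
  \<^term>\<open>Qvirt q j n\<close> is the exponential with base \<open>q\<^sub>j\<close>. The constants are such that
  \<open>Q\<^sup>-\<^sup>1\<^bsub>(m,n]\<^esub>\<close> turns \<^term>\<open>Qvirt q j n\<close> into \<^term>\<open>Qvirt q j m\<close> if \<open>j \<le> m\<close>
  (\<open>Qvirt_times_eigenvalue\<close>); if \<open>m < j \<le> n\<close>, it annihilates it, because the factor
  \<open>Q\<^sub>j\<^sup>-\<^sup>1\<close> has eigenvalue \<open>0\<close>.

  Put \<open>c\<^sub>j = \<Prod>\<^bsub>r < i \<le> t\<^esub> (1 + p\<^sub>i q\<^sub>j)\<close>, the eigenvalue of \<open>R\<^sup>*\<^bsub>(r,t]\<^esub>\<close>. Two formulas follow:
  the matrix \<open>M\<close> is upper triangular with \<open>M\<^sub>i\<^sub>j = c\<^sub>i Q\<^bsub>[i,j]\<^esub>(y\<^sub>j)\<close> for \<open>i \<le> j\<close>, and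
  \<open>h(\<ell>, x) = \<Sum>\<^bsub>n-k \<le> j \<le> n-\<ell>\<^esub> (M\<^sup>-\<^sup>1)\<^bsub>n-k,j\<^esub> c\<^sub>j Q\<^bsub>[j,n-\<ell>]\<^esub>(x)\<close>. In this last form the recursion in
  \<open>\<ell>\<close> is immediate. At \<open>x = y\<^bsub>n-\<ell>\<^esub>\<close> the sum is the entry \<open>(n-k, n-\<ell>)\<close> of \<open>M\<^sup>-\<^sup>1 M\<close>, that is, \<open>0\<close> for
  \<open>\<ell> < k\<close>. For \<open>\<ell> = k\<close> it has the single term \<open>j = n-k\<close>, a multiple of the exponential with base
  \<open>q\<^bsub>n-k\<^esub>\<close>, and the value \<open>1\<close> of the diagonal entry of \<open>M\<^sup>-\<^sup>1 M\<close> fixes the multiple. The inversion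
  formula holds because the eigenvalues of \<open>R\<^sup>*\<^bsub>(r,t]\<^esub>\<close> and of its inverse are reciprocal.

  All sums over \<open>\<int>\<close> are dealt with at once by \<open>exp_eigenkernel_kcomp\<close>: a uniform bound on the
  absolute series, stable under composition, justifies each exchange of summations.
\<close>

section \<open>Kernels with exponential eigenfunctions\<close>

text \<open>
  The sum of the absolute values has a bound \<open>C a\<^sup>x\<close> with the same constant for all \<open>x\<close>. Without
  this uniformity the notion would not be stable under composition.
\<close>

definition exp_eigenkernel :: "real \<Rightarrow> real \<Rightarrow> kernel \<Rightarrow> bool"
  where "exp_eigenkernel a lam K \<longleftrightarrow>
    (\<exists>C. \<forall>x. (\<lambda>z. a powi z * \<bar>K z x\<bar>) summable_on UNIV \<and>
      (\<Sum>\<^sub>\<infinity>z\<in>UNIV. a powi z * \<bar>K z x\<bar>) \<le> C * a powi x) \<and>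
    (\<forall>x. (\<Sum>\<^sub>\<infinity>z\<in>UNIV. a powi z * K z x) = lam * a powi x)"

lemma exp_eigenkernelI:
  assumes "\<And>x. ((\<lambda>z. a powi z * K z x) has_sum lam * a powi x) UNIV"
    and "\<And>x. ((\<lambda>z. a powi z * \<bar>K z x\<bar>) has_sum C * a powi x) UNIV"
  shows "exp_eigenkernel a lam K"
  unfolding exp_eigenkernel_def
  using assms[THEN has_sum_imp_summable] assms[THEN infsumI] by (auto intro!: exI[of _ C])

lemma exp_eigenkernel_has_sum:
  assumes "a > 0" "exp_eigenkernel a lam K"
  shows "((\<lambda>z. a powi z * K z x) has_sum lam * a powi x) UNIV"
proof -
  have "(\<lambda>z. a powi z * \<bar>K z x\<bar>) summable_on UNIV"
    using assms(2) unfolding exp_eigenkernel_def by blast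
  then have "(\<lambda>z. norm (a powi z * K z x)) summable_on UNIV"
    using assms(1) by (simp add: abs_mult)
  then have "((\<lambda>z. a powi z * K z x) has_sum (\<Sum>\<^sub>\<infinity>z\<in>UNIV. a powi z * K z x)) UNIV"
    by (rule has_sum_infsum[OF abs_summable_summable])
  moreover have "(\<Sum>\<^sub>\<infinity>z\<in>UNIV. a powi z * K z x) = lam * a powi x"
    using assms(2) unfolding exp_eigenkernel_def by blast
  ultimately show ?thesis by simp
qed

text \<open>
  The double series of \<open>a\<^sup>z A(z, y) B(y, x)\<close> over \<open>y\<close> and \<open>z\<close> converges absolutely: summation over \<open>z\<close>
  costs a factor \<open>C a\<^sup>y\<close>, and summation over \<open>y\<close> then a factor \<open>D a\<^sup>x\<close>. So its two iterated sums
  agree.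
\<close>

lemma exp_eigenkernel_kcomp:
  assumes a: "a > 0" and A: "exp_eigenkernel a lam A" and B: "exp_eigenkernel a mu B"
  shows "exp_eigenkernel a (lam * mu) (A \<circ>\<^sub>k B)"
proof -
  obtain C where C: "\<And>x. (\<lambda>z. a powi z * \<bar>A z x\<bar>) summable_on UNIV"
      "\<And>x. (\<Sum>\<^sub>\<infinity>z\<in>UNIV. a powi z * \<bar>A z x\<bar>) \<le> C * a powi x"
    using A unfolding exp_eigenkernel_def by blast
  obtain D where D: "\<And>x. (\<lambda>z. a powi z * \<bar>B z x\<bar>) summable_on UNIV"
      "\<And>x. (\<Sum>\<^sub>\<infinity>z\<in>UNIV. a powi z * \<bar>B z x\<bar>) \<le> D * a powi x"
    using B unfolding exp_eigenkernel_def by blast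
  have lam: "(\<Sum>\<^sub>\<infinity>z\<in>UNIV. a powi z * A z x) = lam * a powi x"
    and mu: "(\<Sum>\<^sub>\<infinity>z\<in>UNIV. a powi z * B z x) = mu * a powi x" for x
    using A B unfolding exp_eigenkernel_def by blast+
  have C0: "C \<ge> 0"
  proof -
    have "0 \<le> (\<Sum>\<^sub>\<infinity>z\<in>UNIV. a powi z * \<bar>A z 0\<bar>)"
      using a by (intro infsum_nonneg) auto
    then show ?thesis using C(2)[of 0] by simp
  qed
  define F where "F x y z = a powi z * A z y * B y x" for x y z
  have absF: "\<bar>F x y z\<bar> = \<bar>B y x\<bar> * (a powi z * \<bar>A z y\<bar>)" for x y z
    using a by (simp add: F_def abs_mult)
  have inner: "(\<Sum>\<^sub>\<infinity>z\<in>UNIV. \<bar>F x y z\<bar>) \<le> C * (a powi y * \<bar>B y x\<bar>)"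
    and inner0: "(\<Sum>\<^sub>\<infinity>z\<in>UNIV. \<bar>F x y z\<bar>) \<ge> 0" for x y
  proof -
    have "(\<Sum>\<^sub>\<infinity>z\<in>UNIV. \<bar>F x y z\<bar>) = \<bar>B y x\<bar> * (\<Sum>\<^sub>\<infinity>z\<in>UNIV. a powi z * \<bar>A z y\<bar>)"
      by (simp add: absF infsum_cmult_right')
    also have "\<dots> \<le> \<bar>B y x\<bar> * (C * a powi y)"
      by (intro mult_left_mono C) auto
    finally show "(\<Sum>\<^sub>\<infinity>z\<in>UNIV. \<bar>F x y z\<bar>) \<le> C * (a powi y * \<bar>B y x\<bar>)"
      by (simp add: mult_ac)
    show "(\<Sum>\<^sub>\<infinity>z\<in>UNIV. \<bar>F x y z\<bar>) \<ge> 0"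
      by (intro infsum_nonneg) auto
  qed
  have outer: "(\<lambda>y. \<Sum>\<^sub>\<infinity>z\<in>UNIV. \<bar>F x y z\<bar>) summable_on UNIV" for x
  proof -
    have "(\<lambda>y. norm (\<Sum>\<^sub>\<infinity>z\<in>UNIV. \<bar>F x y z\<bar>)) summable_on UNIV"
      by (rule abs_summable_on_comparison_test'[where g="\<lambda>y. C * (a powi y * \<bar>B y x\<bar>)"])
        (use inner inner0 D(1) in \<open>auto intro!: summable_on_cmult_right\<close>)
    then show ?thesis using inner0 by simp
  qed
  have sumF: "(\<lambda>(y, z). F x y z) abs_summable_on (UNIV \<times> UNIV)" for x
    unfolding abs_summable_on_Sigma_iff
    using outer[of x] inner0[of x] C(1) by (auto simp: absF intro!: summable_on_cmult_right)
  have sumF': "(\<lambda>(z, y). F x y z) abs_summable_on (UNIV \<times> UNIV)" for x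
    using sumF[of x] by (subst summable_on_swap) (simp add: case_prod_unfold)
  have kc: "a powi z * (A \<circ>\<^sub>k B) z x = (\<Sum>\<^sub>\<infinity>y\<in>UNIV. F x y z)" for x z
    unfolding kcomp_def F_def by (simp add: infsum_cmult_right' mult.assoc)
  have row: "(\<lambda>y. \<bar>F x y z\<bar>) summable_on UNIV"
    and rows: "(\<lambda>z. \<Sum>\<^sub>\<infinity>y\<in>UNIV. \<bar>F x y z\<bar>) summable_on UNIV" for x z
  proof -
    show "(\<lambda>y. \<bar>F x y z\<bar>) summable_on UNIV"
      using sumF'[of x] unfolding abs_summable_on_Sigma_iff by auto
    show "(\<lambda>z. \<Sum>\<^sub>\<infinity>y\<in>UNIV. \<bar>F x y z\<bar>) summable_on UNIV"
      using sumF'[of x] unfolding abs_summable_on_Sigma_iff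
      by (auto simp: abs_of_nonneg infsum_nonneg)
  qed
  have le: "a powi z * \<bar>(A \<circ>\<^sub>k B) z x\<bar> \<le> (\<Sum>\<^sub>\<infinity>y\<in>UNIV. \<bar>F x y z\<bar>)" for x z
  proof -
    have "a powi z * \<bar>(A \<circ>\<^sub>k B) z x\<bar> = \<bar>\<Sum>\<^sub>\<infinity>y\<in>UNIV. F x y z\<bar>"
      using a by (simp add: kc[symmetric] abs_mult)
    then show ?thesis
      using norm_infsum_bound[of "\<lambda>y. F x y z" UNIV] row by simp
  qed
  have summ: "(\<lambda>z. a powi z * \<bar>(A \<circ>\<^sub>k B) z x\<bar>) summable_on UNIV" for x
  proof -
    have "(\<lambda>z. norm (a powi z * \<bar>(A \<circ>\<^sub>k B) z x\<bar>)) summable_on UNIV"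
      by (rule abs_summable_on_comparison_test'[OF rows[of x]])
        (use le[of _ x] a in \<open>simp add: abs_mult\<close>)
    then show ?thesis using a by (simp add: abs_mult)
  qed
  have bound: "(\<Sum>\<^sub>\<infinity>z\<in>UNIV. a powi z * \<bar>(A \<circ>\<^sub>k B) z x\<bar>) \<le> C * D * a powi x" for x
  proof -
    have "(\<Sum>\<^sub>\<infinity>z\<in>UNIV. a powi z * \<bar>(A \<circ>\<^sub>k B) z x\<bar>) \<le> (\<Sum>\<^sub>\<infinity>z\<in>UNIV. \<Sum>\<^sub>\<infinity>y\<in>UNIV. \<bar>F x y z\<bar>)"
      by (intro infsum_mono summ rows le)
    also have "\<dots> = (\<Sum>\<^sub>\<infinity>y\<in>UNIV. \<Sum>\<^sub>\<infinity>z\<in>UNIV. \<bar>F x y z\<bar>)"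
      by (rule infsum_swap_banach) (use sumF'[of x] in \<open>simp add: case_prod_unfold\<close>)
    also have "\<dots> \<le> (\<Sum>\<^sub>\<infinity>y\<in>UNIV. C * (a powi y * \<bar>B y x\<bar>))"
      by (intro infsum_mono outer inner summable_on_cmult_right D)
    also have "\<dots> \<le> C * (D * a powi x)"
      by (simp add: infsum_cmult_right' C0 D mult_left_mono)
    finally show ?thesis by (simp add: mult_ac)
  qed
  have eig: "(\<Sum>\<^sub>\<infinity>z\<in>UNIV. a powi z * (A \<circ>\<^sub>k B) z x) = lam * mu * a powi x" for x
  proof -
    have "(\<Sum>\<^sub>\<infinity>z\<in>UNIV. a powi z * (A \<circ>\<^sub>k B) z x) = (\<Sum>\<^sub>\<infinity>z\<in>UNIV. \<Sum>\<^sub>\<infinity>y\<in>UNIV. F x y z)"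
      by (simp add: kc)
    also have "\<dots> = (\<Sum>\<^sub>\<infinity>y\<in>UNIV. \<Sum>\<^sub>\<infinity>z\<in>UNIV. F x y z)"
      by (rule infsum_swap_banach) (use abs_summable_summable[OF sumF'[of x]] in \<open>simp\<close>)
    also have "\<dots> = (\<Sum>\<^sub>\<infinity>y\<in>UNIV. lam * (a powi y * B y x))"
      unfolding F_def infsum_cmult_left' lam by (simp add: mult.assoc)
    finally show ?thesis by (simp only: infsum_cmult_right' mu mult.assoc)
  qed
  show ?thesis
    unfolding exp_eigenkernel_def using summ bound eig by blast
qed

lemma exp_eigenkernel_id: "exp_eigenkernel a 1 id_kernel"
  by (rule exp_eigenkernelI[where C=1])
    (rule has_sum_finite_neutralI[where B="{x}" for x]; auto simp: id_kernel_def)+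

lemma exp_eigenkernel_kprod:
  assumes "a > 0" "distinct is" "\<And>i. i \<in> set is \<Longrightarrow> exp_eigenkernel a (lam i) (K i)"
  shows "exp_eigenkernel a (\<Prod>i\<in>set is. lam i) (kprod (map K is))"
  using assms(2,3)
  by (induction "is")
    (auto simp: kprod_def exp_eigenkernel_id intro!: exp_eigenkernel_kcomp assms(1))

section \<open>Eigenvalues of the kernels\<close>

lemma exp_eigenkernel_Qinv:
  assumes "a > 0"
  shows "exp_eigenkernel a (q i / a - 1) (Qinv q i)"
proof (rule exp_eigenkernelI[where C="\<bar>q i\<bar> / a + 1"])
  fix x
  show "((\<lambda>z. a powi z * Qinv q i z x) has_sum (q i / a - 1) * a powi x) UNIV"
    by (rule has_sum_finite_neutralI[where B="{x, x - 1}"])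
      (use assms in \<open>auto simp: Qinv_def power_int_diff field_simps\<close>)
  show "((\<lambda>z. a powi z * \<bar>Qinv q i z x\<bar>) has_sum (\<bar>q i\<bar> / a + 1) * a powi x) UNIV"
    by (rule has_sum_finite_neutralI[where B="{x, x - 1}"])
      (use assms in \<open>auto simp: Qinv_def power_int_diff field_simps\<close>)
qed

lemma exp_eigenkernel_Rstar:
  assumes "a > 0"
  shows "exp_eigenkernel a (1 + p i * a) (Rstar p i)"
proof (rule exp_eigenkernelI[where C="1 + \<bar>p i\<bar> * a"])
  fix x
  show "((\<lambda>z. a powi z * Rstar p i z x) has_sum (1 + p i * a) * a powi x) UNIV"
    by (rule has_sum_finite_neutralI[where B="{x, x + 1}"])
      (use assms in \<open>auto simp: Rstar_def R_def power_int_add field_simps\<close>)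
  show "((\<lambda>z. a powi z * \<bar>Rstar p i z x\<bar>) has_sum (1 + \<bar>p i\<bar> * a) * a powi x) UNIV"
    by (rule has_sum_finite_neutralI[where B="{x, x + 1}"])
      (use assms in \<open>auto simp: Rstar_def R_def power_int_add field_simps\<close>)
qed

lemma has_sum_geometric_shift:
  fixes a s :: real
  assumes "a > 0" "\<bar>a * s\<bar> < 1"
  shows "((\<lambda>z. a powi z * (if x \<le> z then s powi (z - x) else 0)) has_sum 1 / (1 - a * s) * a powi x) UNIV"
proof -
  have "((\<lambda>n. (a * s) ^ n) has_sum 1 / (1 - a * s)) UNIV"
    using assms by (intro norm_summable_imp_has_sum geometric_sums)
      (auto simp: power_abs intro!: summable_geometric)
  then have "((\<lambda>n. (a * s) ^ n * a powi x) has_sum 1 / (1 - a * s) * a powi x) UNIV"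
    by (rule has_sum_cmult_left)
  also have "?this \<longleftrightarrow> ((\<lambda>z. a powi z * s powi (z - x)) has_sum 1 / (1 - a * s) * a powi x) {x..}"
    using assms(1)
    by (intro has_sum_reindex_bij_witness[of _ "\<lambda>z. nat (z - x)" "\<lambda>n. x + int n"])
      (auto simp: power_int_add power_mult_distrib)
  also have "\<dots> \<longleftrightarrow> ?thesis"
    by (rule has_sum_cong_neutral) auto
  finally show ?thesis .
qed

lemma exp_eigenkernel_Rstar_inv1:
  assumes "a > 0" "p i > 0" "p i * a < 1"
  shows "exp_eigenkernel a (1 / (1 + p i * a)) (Rstar_inv1 p i)"
proof (rule exp_eigenkernelI[where C="1 / (1 - p i * a)"])
  fix x
  show "((\<lambda>z. a powi z * Rstar_inv1 p i z x) has_sum 1 / (1 + p i * a) * a powi x) UNIV"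
    using has_sum_geometric_shift[of a "- p i" x] assms
    by (simp add: Rstar_inv1_def abs_mult mult.commute)
  have "\<bar>Rstar_inv1 p i z x\<bar> = (if x \<le> z then p i powi (z - x) else 0)" for z
    using assms by (simp add: Rstar_inv1_def power_int_abs[symmetric])
  then show "((\<lambda>z. a powi z * \<bar>Rstar_inv1 p i z x\<bar>) has_sum 1 / (1 - p i * a) * a powi x) UNIV"
    using has_sum_geometric_shift[of a "p i" x] assms
    by (simp add: abs_mult mult.commute)
qed

lemma exp_eigenkernel_Qinv_range:
  assumes "a > 0"
  shows "exp_eigenkernel a (\<Prod>i\<in>{m<..n}. q i / a - 1) (Qinv_range q m n)"
proof -
  have "set (rev [Suc m..<Suc n]) = {m<..n}" by auto
  then show ?thesis
    using exp_eigenkernel_kprod[OF assms _ exp_eigenkernel_Qinv[OF assms], of "rev [Suc m..<Suc n]"]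
    unfolding Qinv_range_def by (simp del: upt_Suc)
qed

lemma exp_eigenkernel_Rstar_range:
  assumes "a > 0"
  shows "exp_eigenkernel a (\<Prod>i\<in>{r<..t}. 1 + p i * a) (Rstar_range p r t)"
proof -
  have "set (rev [Suc r..<Suc t]) = {r<..t}" by auto
  then show ?thesis
    using exp_eigenkernel_kprod[OF assms _ exp_eigenkernel_Rstar[OF assms], of "rev [Suc r..<Suc t]"]
    unfolding Rstar_range_def by (simp del: upt_Suc)
qed

lemma exp_eigenkernel_Rstar_inv:
  assumes "a > 0" "\<And>i. i \<in> {r<..t} \<Longrightarrow> p i > 0" "\<And>i. i \<in> {r<..t} \<Longrightarrow> p i * a < 1"
  shows "exp_eigenkernel a (\<Prod>i\<in>{r<..t}. 1 / (1 + p i * a)) (Rstar_inv p r t)"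
proof -
  have s: "set [Suc r..<Suc t] = {r<..t}" by auto
  show ?thesis
    unfolding Rstar_inv_def s[symmetric]
    using assms by (intro exp_eigenkernel_kprod exp_eigenkernel_Rstar_inv1) (auto simp del: upt_Suc)
qed

section \<open>Action on the virtual-variable functions\<close>

lemma Qvirt_has_sum:
  assumes "q j > 0" "exp_eigenkernel (q j) lam K"
  shows "((\<lambda>z. Qvirt q j m z * K z x) has_sum lam * Qvirt q j m x) UNIV"
proof -
  define c where "c = q j powi (int m - int j) / (\<Prod>l = j + 1..m. q l - q j)"
  have Q: "Qvirt q j m z = c * q j powi z" for z
    using assms(1) by (simp add: Qvirt_def c_def power_int_add[symmetric] algebra_simps)
  show ?thesis
    using has_sum_cmult_right[OF exp_eigenkernel_has_sum[OF assms, of x], of c]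
    by (simp add: Q mult_ac)
qed

lemma sum_Qvirt_has_sum:
  assumes "\<And>j. j \<in> J \<Longrightarrow> q j > 0" "\<And>j. j \<in> J \<Longrightarrow> exp_eigenkernel (q j) (lam j) K"
  shows "((\<lambda>z. (\<Sum>j\<in>J. w j * Qvirt q j m z) * K z x) has_sum
    (\<Sum>j\<in>J. w j * lam j * Qvirt q j m x)) UNIV"
proof -
  have "((\<lambda>z. \<Sum>j\<in>J. w j * (Qvirt q j m z * K z x)) has_sum
      (\<Sum>j\<in>J. w j * (lam j * Qvirt q j m x))) UNIV"
    using assms by (induction J rule: infinite_finite_induct)
      (auto intro!: has_sum_add has_sum_cmult_right Qvirt_has_sum)
  then show ?thesis by (simp add: sum_distrib_right mult.assoc)
qed

lemma sum_Qvirt_fcomp: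
  assumes "\<And>j. j \<in> J \<Longrightarrow> q j > 0" "\<And>j. j \<in> J \<Longrightarrow> exp_eigenkernel (q j) (lam j) K"
  shows "((\<lambda>z. \<Sum>j\<in>J. w j * Qvirt q j m z) \<circ>\<^sub>f K) = (\<lambda>x. \<Sum>j\<in>J. w j * lam j * Qvirt q j m x)"
  unfolding fcomp_def using infsumI[OF sum_Qvirt_has_sum[OF assms]] by fast

text \<open>
  The eigenvalue \<open>(q\<^sub>l - q\<^sub>j) / q\<^sub>j\<close> of \<open>Q\<^sub>l\<^sup>-\<^sup>1\<close> cancels one factor of the denominator and lowers the
  exponent by one.
\<close>

lemma Qvirt_times_eigenvalue:
  assumes "j \<le> m" "m \<le> n" "q j > 0" "\<And>l. l \<in> {m<..n} \<Longrightarrow> q l \<noteq> q j"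
  shows "(\<Prod>l\<in>{m<..n}. q l / q j - 1) * Qvirt q j n x = Qvirt q j m x"
proof -
  have disj: "{j + 1..m} \<inter> {m<..n} = {}" by auto
  have "{j + 1..n} = {j + 1..m} \<union> {m<..n}" using assms by auto
  then have P: "(\<Prod>l = j + 1..n. q l - q j) = (\<Prod>l = j + 1..m. q l - q j) * (\<Prod>l\<in>{m<..n}. q l - q j)"
    by (metis finite_atLeastAtMost finite_greaterThanAtMost prod.union_disjoint disj)
  have nz: "(\<Prod>l\<in>{m<..n}. q l - q j) \<noteq> 0" using assms(4) by simp
  have "q l / q j - 1 = (q l - q j) / q j" for l
    using assms(3) by (simp add: field_simps)
  then have E: "(\<Prod>l\<in>{m<..n}. q l / q j - 1) = (\<Prod>l\<in>{m<..n}. q l - q j) / q j ^ (n - m)"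
    by (simp add: prod_dividef)
  have "x + int n - int j = (x + int m - int j) + int (n - m)" using assms(2) by simp
  then have "q j powi (x + int n - int j) = q j powi (x + int m - int j) * q j ^ (n - m)"
    using assms(3) by (metis less_irrefl power_int_add power_int_of_nat)
  then show ?thesis
    unfolding Qvirt_def P E using nz assms(3) by simp
qed

lemma eigenvalue_Qinv_range_eq_0:
  fixes q :: "nat \<Rightarrow> real"
  assumes "m < j" "j \<le> n" "q j > 0"
  shows "(\<Prod>l\<in>{m<..n}. q l / q j - 1) = 0"
  using assms by (intro prod_zero) auto

section \<open>The matrix and its inverse\<close>

text \<open>Nonzero diagonal entries allow a column-by-column induction along a row of the left inverse.\<close>

lemma left_inverse_of_upper_triangular:
  fixes A B :: "nat \<Rightarrow> nat \<Rightarrow> 'a :: field"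
  assumes upper: "\<And>i j. i \<in> {1..N} \<Longrightarrow> j \<in> {1..N} \<Longrightarrow> j < i \<Longrightarrow> A i j = 0"
    and diag: "\<And>i. i \<in> {1..N} \<Longrightarrow> A i i \<noteq> 0"
    and inv: "\<And>i j. i \<in> {1..N} \<Longrightarrow> j \<in> {1..N} \<Longrightarrow>
      (\<Sum>l\<in>{1..N}. B i l * A l j) = (if i = j then 1 else 0)"
    and ij: "i \<in> {1..N}" "j \<in> {1..N}" "j < i"
  shows "B i j = 0"
  using ij(2,3)
proof (induction j rule: less_induct)
  case (less j)
  have "0 = (\<Sum>l\<in>{1..N}. B i l * A l j)"
    using inv[OF ij(1) less.prems(1)] less.prems by simp
  also have "\<dots> = (\<Sum>l\<in>{1..N}. if l = j then B i j * A j j else 0)"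
  proof (rule sum.cong[OF refl])
    fix l assume l: "l \<in> {1..N}"
    consider "l < j" | "l = j" | "j < l" by linarith
    then show "B i l * A l j = (if l = j then B i j * A j j else 0)"
      by cases (use less l upper in auto)
  qed
  also have "\<dots> = B i j * A j j" using less.prems by simp
  finally show ?case using diag[OF less.prems(1)] by simp
qed

lemma M_eq:
  assumes pos: "\<And>j. j \<in> {1..N} \<Longrightarrow> q j > 0" and inj: "inj_on q {1..N}"
    and i: "i \<in> {1..N}" and j: "j \<in> {1..N}"
  shows "M p q y r t N i j =
    (if i \<le> j then (\<Prod>s\<in>{r<..t}. 1 + p s * q i) * Qvirt q i j (y j) else 0)"
proof -
  let ?c = "\<Prod>s\<in>{r<..t}. 1 + p s * q i" and ?d = "\<Prod>l\<in>{j<..N}. q l / q i - 1"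
  have "exp_eigenkernel (q i) (?c * ?d) (Rstar_range p r t \<circ>\<^sub>k Qinv_range q j N)"
    using pos i by (intro exp_eigenkernel_kcomp exp_eigenkernel_Rstar_range exp_eigenkernel_Qinv_range) auto
  then have M: "M p q y r t N i j = ?c * ?d * Qvirt q i N (y j)"
    unfolding M_def Psi_def using Qvirt_has_sum pos i by (blast intro: infsumI)
  show ?thesis
  proof (cases "i \<le> j")
    case True
    then have "q l \<noteq> q i" if "l \<in> {j<..N}" for l
      using that i inj by (auto dest: inj_onD)
    then have "?d * Qvirt q i N (y j) = Qvirt q i j (y j)"
      using True i j pos by (intro Qvirt_times_eigenvalue) auto
    with True show ?thesis by (simp add: M mult.assoc)
  next
    case False
    then show ?thesis
      using eigenvalue_Qinv_range_eq_0[of j i N q] i pos by (simp add: M)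
  qed
qed

text \<open>
  The definition of \<^const>\<open>M_inv\<close> uses \<^const>\<open>mat_inverse\<close>, which returns \<^const>\<open>None\<close> for a
  singular matrix; the product of the diagonal entries excludes this case.
\<close>

lemma M_inv_times_M:
  assumes upper: "\<And>i j. i \<in> {1..N} \<Longrightarrow> j \<in> {1..N} \<Longrightarrow> j < i \<Longrightarrow> M p q y r t N i j = 0"
    and diag: "\<And>i. i \<in> {1..N} \<Longrightarrow> M p q y r t N i i \<noteq> 0"
    and i: "i \<in> {1..N}" and j: "j \<in> {1..N}"
  shows "(\<Sum>l\<in>{1..N}. M_inv p q y r t N i l * M p q y r t N l j) = (if i = j then 1 else 0)"
proof -
  let ?A = "M_mat p q y r t N"
  have A: "?A \<in> carrier_mat N N" by (simp add: M_mat_def)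
  have "upper_triangular ?A"
    by (rule upper_triangularI) (use upper in \<open>auto simp: M_mat_def\<close>)
  then have "det ?A = prod_list (diag_mat ?A)"
    using A by (rule det_upper_triangular)
  also have "\<dots> \<noteq> 0"
    using diag by (auto simp: prod_list_zero_iff diag_mat_def M_mat_def)
  finally have "?A \<in> Units (ring_mat TYPE(real) N ())"
    by (intro det_non_zero_imp_unit A)
  then obtain B where B: "mat_inverse ?A = Some B"
    using mat_inverse(1)[OF A, where b="()"] by (cases "mat_inverse ?A") auto
  then have BA: "B * ?A = 1\<^sub>m N" and Bc: "B \<in> carrier_mat N N"
    using mat_inverse(2)[OF A] by auto
  have W: "M_inv p q y r t N i l = B $$ (i - 1, l - 1)" for l
    by (simp add: M_inv_def B)
  have "(\<Sum>l\<in>{1..N}. M_inv p q y r t N i l * M p q y r t N l j) =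
      (\<Sum>l\<in>{0..<N}. B $$ (i - 1, l) * ?A $$ (l, j - 1))"
    by (rule sum.reindex_bij_witness[of _ Suc "\<lambda>l. l - 1"])
      (use j in \<open>auto simp: W M_mat_def\<close>)
  also have "\<dots> = (B * ?A) $$ (i - 1, j - 1)"
    using i j A Bc by (auto simp: scalar_prod_def)
  also have "\<dots> = (if i = j then 1 else 0)"
    using i j by (auto simp: BA)
  finally show ?thesis .
qed

section \<open>The terminal-boundary value problem\<close>

theorem proposition4p2:
  fixes N r t n k :: nat and p q :: "nat \<Rightarrow> real" and y :: "nat \<Rightarrow> int"
  assumes "N \<ge> 2"
    and "\<And>i. i \<ge> 1 \<Longrightarrow> p i > 0"
    and "r < t"
    and "1 < q 1" and "strict_mono_on {1..N} q"
    and "\<And>i j. i \<ge> 1 \<Longrightarrow> j \<in> {1..N} \<Longrightarrow> p i * q j < 1"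
    and "\<And>i j. 1 \<le> i \<Longrightarrow> i < j \<Longrightarrow> j \<le> N \<Longrightarrow> y i > y j"
    and "n \<le> N" and "k < n"
  shows "solves_terminal_boundary_problem q y n k (h_sol p q y r t N n k) \<and>
    (\<forall>x. (\<lambda>z. h_sol p q y r t N n k 0 z * Rstar_inv p r t z x) summable_on UNIV \<and>
      Phi p q y r t N n (n - k) x = (h_sol p q y r t N n k 0 \<circ>\<^sub>f Rstar_inv p r t) x)"
proof -
  have q1: "q j > 1" if "j \<in> {1..N}" for j
  proof (cases "j = 1")
    case False
    then have "q 1 < q j" using that by (intro strict_mono_onD[OF assms(5)]) auto
    then show ?thesis using assms(4) by simp
  qed (use assms(4) in simp)
  then have qpos: "q j > 0" if "j \<in> {1..N}" for j using that by force
  have inj: "inj_on q {1..N}" by (rule strict_mono_on_imp_inj_on[OF assms(5)])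
  define c where "c j = (\<Prod>s\<in>{r<..t}. 1 + p s * q j)" for j
  have factor: "1 + p s * q j > 0" if "s \<in> {r<..t}" "j \<in> {1..N}" for s j
    using assms(2)[of s] qpos[of j] that by (simp add: add_pos_pos)
  have cpos: "c j > 0" if "j \<in> {1..N}" for j
    unfolding c_def using factor that by (intro prod_pos) auto
  let ?M = "M p q y r t N" and ?W = "M_inv p q y r t N"
  have M: "?M i j = (if i \<le> j then c i * Qvirt q i j (y j) else 0)"
    if "i \<in> {1..N}" "j \<in> {1..N}" for i j
    unfolding c_def using that qpos inj by (intro M_eq) auto
  have diag: "?M i i = c i * q i powi y i" if "i \<in> {1..N}" for i
    using M that by (simp add: Qvirt_def)
  have diag0: "?M i i \<noteq> 0" if "i \<in> {1..N}" for i
    using diag[OF that] cpos[OF that] qpos[OF that] by simp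
  have inv: "(\<Sum>l\<in>{1..N}. ?W i l * ?M l j) = (if i = j then 1 else 0)"
    if "i \<in> {1..N}" "j \<in> {1..N}" for i j
    using that M diag0 by (intro M_inv_times_M) auto
  have W0: "?W i j = 0" if "i \<in> {1..N}" "j \<in> {1..N}" "j < i" for i j
    by (rule left_inverse_of_upper_triangular[of N ?M ?W, OF _ diag0 inv that]) (simp_all add: M)

  \<comment> \<open>By triangularity only \<open>i \<le> l \<le> j\<close> contributes to the product of the matrices.\<close>
  have orth: "(\<Sum>l = i..j. ?W i l * c l * Qvirt q l j (y j)) = (if i = j then 1 else 0)"
    if "i \<in> {1..N}" "j \<in> {1..N}" for i j
  proof -
    have "(\<Sum>l = i..j. ?W i l * c l * Qvirt q l j (y j)) = (\<Sum>l = i..j. ?W i l * ?M l j)"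
      using that by (intro sum.cong) (auto simp: M)
    also have "\<dots> = (\<Sum>l\<in>{1..N}. ?W i l * ?M l j)"
      using that by (intro sum.mono_neutral_left) (auto simp: M W0 not_le)
    finally show ?thesis using inv[OF that] by simp
  qed

  have Phi: "Phi p q y r t N n (n - k) = (\<lambda>x. \<Sum>j = n - k..n. ?W (n - k) j * Qvirt q j n x)"
    by (simp add: Phi_def fun_eq_iff)
  have J: "j \<in> {1..N}" if "j \<in> {n - k..n}" for j
    using that assms(8,9) by auto
  have h: "h_sol p q y r t N n k l = (\<lambda>x. \<Sum>j = n - k..n - l. ?W (n - k) j * c j * Qvirt q j (n - l) x)"
    if "l \<le> k" for l
  proof -
    let ?d = "\<lambda>j. \<Prod>s\<in>{n - l<..n}. q s / q j - 1"
    have "h_sol p q y r t N n k l = (Phi p q y r t N n (n - k) \<circ>\<^sub>f Rstar_range p r t \<circ>\<^sub>f Qinv_range q (n - l) n)"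
      by (simp add: h_sol_def fun_eq_iff)
    also have "Phi p q y r t N n (n - k) \<circ>\<^sub>f Rstar_range p r t =
        (\<lambda>x. \<Sum>j = n - k..n. ?W (n - k) j * c j * Qvirt q j n x)"
      unfolding Phi c_def by (rule sum_Qvirt_fcomp) (use J qpos exp_eigenkernel_Rstar_range in blast)+
    also have "\<dots> \<circ>\<^sub>f Qinv_range q (n - l) n =
        (\<lambda>x. \<Sum>j = n - k..n. ?W (n - k) j * c j * ?d j * Qvirt q j n x)"
      by (rule sum_Qvirt_fcomp) (use J qpos exp_eigenkernel_Qinv_range in blast)+
    also have "\<dots> = (\<lambda>x. \<Sum>j = n - k..n - l. ?W (n - k) j * c j * ?d j * Qvirt q j n x)"
    proof (intro ext sum.mono_neutral_right ballI)
      fix x j assume "j \<in> {n - k..n} - {n - k..n - l}"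
      then have "j \<in> {n - k..n}" "n - l < j" "j \<le> n" by auto
      then have "?d j = 0"
        using qpos[OF J] by (intro eigenvalue_Qinv_range_eq_0)
      then show "?W (n - k) j * c j * ?d j * Qvirt q j n x = 0"
        by (simp only: mult_zero_left mult_zero_right)
    qed auto
    also have "\<dots> = (\<lambda>x. \<Sum>j = n - k..n - l. ?W (n - k) j * c j * Qvirt q j (n - l) x)"
    proof (intro ext sum.cong[OF refl])
      fix x j assume j: "j \<in> {n - k..n - l}"
      then have jN: "j \<in> {1..N}" using J by auto
      have "q s \<noteq> q j" if "s \<in> {n - l<..n}" for s
        using that j jN assms(8) inj by (auto dest: inj_onD)
      then have "?d j * Qvirt q j n x = Qvirt q j (n - l) x"
        using j qpos[OF jN] by (intro Qvirt_times_eigenvalue) auto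
      then show "?W (n - k) j * c j * ?d j * Qvirt q j n x = ?W (n - k) j * c j * Qvirt q j (n - l) x"
        by (simp add: mult.assoc)
    qed
    finally show ?thesis .
  qed

  have step: "h_sol p q y r t N n k (l + 1) x = (h_sol p q y r t N n k l \<circ>\<^sub>f Qinv q (n - l)) x"
    if l: "l < k" for l x
  proof -
    let ?e = "\<lambda>j. q (n - l) / q j - 1"
    have "(h_sol p q y r t N n k l \<circ>\<^sub>f Qinv q (n - l)) =
        (\<lambda>x. \<Sum>j = n - k..n - l. ?W (n - k) j * c j * ?e j * Qvirt q j (n - l) x)"
      unfolding h[OF less_imp_le[OF l]]
      by (rule sum_Qvirt_fcomp) (use J qpos in \<open>auto intro!: exp_eigenkernel_Qinv\<close>)
    then have "(h_sol p q y r t N n k l \<circ>\<^sub>f Qinv q (n - l)) x =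
        (\<Sum>j = n - k..n - l. ?W (n - k) j * c j * ?e j * Qvirt q j (n - l) x)" by simp
    \<comment> \<open>The top term \<open>j = n - l\<close> has eigenvalue \<open>0\<close>.\<close>
    also have "\<dots> = (\<Sum>j = n - k..n - (l + 1). ?W (n - k) j * c j * ?e j * Qvirt q j (n - l) x)"
    proof (rule sum.mono_neutral_right)
      show "\<forall>j\<in>{n - k..n - l} - {n - k..n - (l + 1)}.
          ?W (n - k) j * c j * ?e j * Qvirt q j (n - l) x = 0"
      proof
        fix j assume "j \<in> {n - k..n - l} - {n - k..n - (l + 1)}"
        then have "j = n - l" and "j \<in> {1..N}" using J by auto
        then show "?W (n - k) j * c j * ?e j * Qvirt q j (n - l) x = 0"
          using qpos[of j] by simp
      qed
    qed auto
    also have "\<dots> = (\<Sum>j = n - k..n - (l + 1). ?W (n - k) j * c j * Qvirt q j (n - (l + 1)) x)"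
    proof (rule sum.cong[OF refl])
      fix j assume j: "j \<in> {n - k..n - (l + 1)}"
      then have jN: "j \<in> {1..N}" and ne: "j < n - l" using J l assms(9) by auto
      have single: "{n - (l + 1)<..n - l} = {n - l}" using l assms(9) by auto
      have "q (n - l) \<noteq> q j"
        using jN ne assms(8) inj by (auto dest: inj_onD)
      then have "?e j * Qvirt q j (n - l) x = Qvirt q j (n - (l + 1)) x"
        using Qvirt_times_eigenvalue[of j "n - (l + 1)" "n - l" q x] j qpos[OF jN]
        unfolding single by auto
      then show "?W (n - k) j * c j * ?e j * Qvirt q j (n - l) x =
          ?W (n - k) j * c j * Qvirt q j (n - (l + 1)) x"
        by (simp add: mult.assoc)
    qed
    finally show ?thesis using h[of "l + 1"] l by simp
  qed

  have boundary: "h_sol p q y r t N n k l (y (n - l)) = 0" if "l < k" for l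
    using orth[of "n - k" "n - l"] that J[of "n - k"] J[of "n - l"] assms(9)
    by (simp add: h[OF less_imp_le[OF that]])

  have final: "h_sol p q y r t N n k k x = q (n - k) powi (x - y (n - k))" for x
  proof -
    let ?m = "n - k"
    have m: "?m \<in> {1..N}" using J by auto
    have "?W ?m ?m * c ?m * q ?m powi y ?m = 1"
      using orth[OF m m] by (simp add: Qvirt_def)
    then have "?W ?m ?m * c ?m = 1 / q ?m powi y ?m"
      using qpos[OF m] by (simp add: field_simps)
    then show ?thesis
      using qpos[OF m] by (simp add: h Qvirt_def power_int_diff)
  qed

  have "(\<lambda>z. h_sol p q y r t N n k 0 z * Rstar_inv p r t z x) summable_on UNIV \<and>
      Phi p q y r t N n (n - k) x = (h_sol p q y r t N n k 0 \<circ>\<^sub>f Rstar_inv p r t) x" for x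
  proof -
    let ?b = "\<lambda>j. \<Prod>s\<in>{r<..t}. 1 / (1 + p s * q j)"
    have E: "exp_eigenkernel (q j) (?b j) (Rstar_inv p r t)" if "j \<in> {n - k..n}" for j
      using J[OF that] qpos assms(2,6) by (intro exp_eigenkernel_Rstar_inv) auto
    have S: "((\<lambda>z. h_sol p q y r t N n k 0 z * Rstar_inv p r t z x) has_sum
        (\<Sum>j = n - k..n. ?W (n - k) j * c j * ?b j * Qvirt q j n x)) UNIV"
      using sum_Qvirt_has_sum[of "{n - k..n}" q ?b, OF qpos[OF J] E] by (simp add: h)
    have "c j * ?b j = 1" if "j \<in> {n - k..n}" for j
      using cpos[OF J[OF that]] by (simp add: c_def prod_dividef del: prod_zero_iff)
    then have "(\<Sum>j = n - k..n. ?W (n - k) j * c j * ?b j * Qvirt q j n x) = Phi p q y r t N n (n - k) x"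
      by (simp add: Phi mult.assoc)
    with S have "((\<lambda>z. h_sol p q y r t N n k 0 z * Rstar_inv p r t z x) has_sum
        Phi p q y r t N n (n - k) x) UNIV" by simp
    then show ?thesis
      unfolding fcomp_def by (metis has_sum_imp_summable infsumI)
  qed
  then show ?thesis
    unfolding solves_terminal_boundary_problem_def using step boundary final by blast
qed

end
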